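(* Let $V$ be a real $4n$-dimensional vector space equipped with a hypercomplex structure $H=(J_1,J_2,J_3)$, and let $\mathcal{B}(V)$ be the vector space of all bilinear forms $f:V\times V\to\mathbb{R}$. Define linear operators $\Pi_0,\Pi_1,\Pi_2,\Pi_3$ on $\mathcal{B}(V)$ by $$(\Pi_0 f)(x,y)=\tfrac14\{f(x,y)+f(J_1x,J_1y)+f(J_2x,J_2y)+f(J_3x,J_3y)\},$$ $$(\Pi_\alpha f)(x,y)=\tfrac14\{f(x,y)+f(J_\alpha x,J_\alpha y)-f(J_\beta x,J_\beta y)-f(J_\gamma x,J_\gamma y)\},\qquad \alpha=1,2,3,$$ where $(\alpha,\beta,\gamma)$ is a cyclic permutation of $(1,2,3)$. Let $\mathcal{B}_0$ be the space of Hermitian bilinear forms with respect to $H$, and for $\alpha=1,2,3$ let $\mathcal{B}_\alpha$ be the space of pseudo-Hermitian bilinear forms of type $\alpha$ with respect to $H$. Then $$\mathcal{B}(V)=\mathcal{B}_0\oplus\mathcal{B}_1\oplus\mathcal{B}_2\oplus\mathcal{B}_3,\qquad \mathcal{B}_\alpha=\mathrm{Im}\,\Pi_\alpha,\quad \alpha=0,1,2,3,$$ and the operators $\Pi_0,\Pi_1,\Pi_2,\Pi_3$ are projectors satisfying $$\Pi_\alpha^2=\Pi_\alpha,\qquad \Pi_0+\Pi_1+\Pi_2+\Pi_3=\mathrm{Id},\qquad \Pi_\alpha\circ\Pi_\beta=\Pi_\beta\circ\Pi_\alpha=0\ \ (\alpha\neq\beta),\qquad \alpha,\beta\in\{0,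1,2,3\}.$$
   Context: A hypercomplex structure on $V$ is a triple $H=(J_1,J_2,J_3)$ of pairwise anticommuting complex structures (endomorphisms with $J_\alpha^2=-\mathrm{Id}$) with $J_3=J_1J_2$. A bilinear form $f$ on $V$ is Hermitian with respect to $H$ if $f(J_\alpha x,J_\alpha y)=f(x,y)$ for all $x,y\in V$ and all $\alpha=1,2,3$. For $\alpha\in\{1,2,3\}$, $f$ is pseudo-Hermitian of type $\alpha$ with respect to $H$ (i.e. $f\in\mathcal{B}_\alpha$) if $f(J_\alpha x,J_\alpha y)=-f(J_\beta x,J_\beta y)=-f(J_\gamma x,J_\gamma y)=f(x,y)$ for all $x,y\in V$, where $(\alpha,\beta,\gamma)$ is a cyclic permutation of $(1,2,3)$. Bilinear forms are not assumed symmetric. *)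

theory Defs
  imports "HOL-Analysis.Analysis" "HOL-Library.Function_Algebras"
begin

definition complex_structure :: "('v::real_vector \<Rightarrow> 'v) \<Rightarrow> bool" where
  "complex_structure J \<longleftrightarrow> linear J \<and> (\<forall>x. J (J x) = - x)"

type_synonym 'v endo_triple = "('v \<Rightarrow> 'v) \<times> ('v \<Rightarrow> 'v) \<times> ('v \<Rightarrow> 'v)"

text \<open>The component \<open>J\<^sub>\<alpha>\<close> of \<open>H = (J\<^sub>1, J\<^sub>2, J\<^sub>3)\<close>; only used for \<open>\<alpha> \<in> {1, 2, 3}\<close>.\<close>
fun cmp :: "'v endo_triple \<Rightarrow> nat \<Rightarrow> 'v \<Rightarrow> 'v" where
  "cmp (J1, J2, J3) \<alpha> = (if \<alpha> = 1 then J1 else if \<alpha> = 2 then J2 else J3)"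

definition hypercomplex_structure :: "('v::real_vector) endo_triple \<Rightarrow> bool" where
  "hypercomplex_structure H \<longleftrightarrow>
     (\<forall>\<alpha>\<in>{1,2,3}. complex_structure (cmp H \<alpha>)) \<and>
     (\<forall>\<alpha>\<in>{1,2,3}. \<forall>\<beta>\<in>{1,2,3}. \<alpha> \<noteq> \<beta> \<longrightarrow>
        (\<forall>x. cmp H \<alpha> (cmp H \<beta> x) = - cmp H \<beta> (cmp H \<alpha> x))) \<and>
     cmp H 3 = cmp H 1 \<circ> cmp H 2"

text \<open>The cycle \<open>1 \<mapsto> 2 \<mapsto> 3 \<mapsto> 1\<close>: for \<open>\<alpha> \<in> {1, 2, 3}\<close>, the cyclic permutation
  \<open>(\<alpha>, \<beta>, \<gamma>)\<close> of \<open>(1, 2, 3)\<close> has \<open>\<beta> = cyc \<alpha>\<close> and \<open>\<gamma> = cyc (cyc \<alpha>)\<close>.\<close>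
definition cyc :: "nat \<Rightarrow> nat" where
  "cyc \<alpha> = \<alpha> mod 3 + 1"

type_synonym 'v form = "'v \<Rightarrow> 'v \<Rightarrow> real"

text \<open>Addition and zero of forms are the pointwise ones of \<open>Function_Algebras\<close>.\<close>
definition form_scale :: "real \<Rightarrow> 'v form \<Rightarrow> 'v form" where
  "form_scale c f = (\<lambda>x y. c * f x y)"

global_interpretation form: vector_space form_scale
  by unfold_locales (auto simp: form_scale_def fun_eq_iff algebra_simps)

definition bilinear_forms :: "('v::real_vector) form set" where
  "bilinear_forms = {f. bilinear f}"

definition hermitian :: "('v::real_vector) endo_triple \<Rightarrow> 'v form \<Rightarrow> bool" where
  "hermitian H f \<longleftrightarrow> (\<forall>\<alpha>\<in>{1,2,3}. \<forall>x y. f (cmp H \<alpha> x) (cmp H \<alpha> y) = f x y)"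

definition pseudo_hermitian :: "('v::real_vector) endo_triple \<Rightarrow> nat \<Rightarrow> 'v form \<Rightarrow> bool" where
  "pseudo_hermitian H \<alpha> f \<longleftrightarrow>
     (let \<beta> = cyc \<alpha>; \<gamma> = cyc (cyc \<alpha>) in
      \<forall>x y. f (cmp H \<alpha> x) (cmp H \<alpha> y) = - f (cmp H \<beta> x) (cmp H \<beta> y) \<and>
            - f (cmp H \<beta> x) (cmp H \<beta> y) = - f (cmp H \<gamma> x) (cmp H \<gamma> y) \<and>
            - f (cmp H \<gamma> x) (cmp H \<gamma> y) = f x y)"

definition form_space :: "('v::real_vector) endo_triple \<Rightarrow> nat \<Rightarrow> 'v form set" where
  "form_space H \<alpha> =
     (if \<alpha> = 0 then {f \<in> bilinear_forms. hermitian H f}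
      else {f \<in> bilinear_forms. pseudo_hermitian H \<alpha> f})"

text \<open>The operators are defined on all functions \<open>V \<times> V \<rightarrow> \<real>\<close>; as operators on the space of
  bilinear forms they are considered on \<open>bilinear_forms\<close> only.\<close>
definition form_proj :: "('v::real_vector) endo_triple \<Rightarrow> nat \<Rightarrow> 'v form \<Rightarrow> 'v form" where
  "form_proj H \<alpha> f =
     (if \<alpha> = 0 then
        (\<lambda>x y. 1/4 * (f x y + f (cmp H 1 x) (cmp H 1 y)
                            + f (cmp H 2 x) (cmp H 2 y) + f (cmp H 3 x) (cmp H 3 y)))
      else
        (let \<beta> = cyc \<alpha>; \<gamma> = cyc (cyc \<alpha>) in
         (\<lambda>x y. 1/4 * (f x y + f (cmp H \<alpha> x) (cmp H \<alpha> y)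
                            - f (cmp H \<beta> x) (cmp H \<beta> y) - f (cmp H \<gamma> x) (cmp H \<gamma> y)))))"

definition linear_operator_on :: "'v form set \<Rightarrow> ('v form \<Rightarrow> 'v form) \<Rightarrow> bool" where
  "linear_operator_on U P \<longleftrightarrow>
     form.subspace U \<and> P ` U \<subseteq> U \<and>
     (\<forall>f\<in>U. \<forall>g\<in>U. P (f + g) = P f + P g) \<and>
     (\<forall>c. \<forall>f\<in>U. P (form_scale c f) = form_scale c (P f))"

text \<open>\<open>U\<close> is the internal direct sum of the subspaces \<open>W i\<close>, \<open>i \<in> I\<close>. Families
  are taken in the extensional product \<open>PiE\<close> so that uniqueness concerns values on \<open>I\<close> only.\<close>
definition is_direct_sum :: "'v form set \<Rightarrow> 'i set \<Rightarrow> ('i \<Rightarrow> 'v form set) \<Rightarrow> bool" where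
  "is_direct_sum U I W \<longleftrightarrow>
     finite I \<and> form.subspace U \<and> (\<forall>i\<in>I. form.subspace (W i) \<and> W i \<subseteq> U) \<and>
     (\<forall>f\<in>U. \<exists>!g. g \<in> PiE I W \<and> f = (\<Sum>i\<in>I. g i))"

end

theory Submission
  imports Defs
begin

text \<open>For a bilinear form \<open>f\<close> the signs in \<open>J\<^sub>\<alpha>J\<^sub>\<beta> = \<plusminus>J\<^sub>\<gamma>\<close> cancel, so \<open>f \<mapsto> f(J\<^sub>\<alpha>\<sqdot>, J\<^sub>\<alpha>\<sqdot>)\<close>,
  \<open>\<alpha> = 1, 2, 3\<close>, generate an action of the Klein four-group. The spaces \<open>\<B>\<^sub>\<alpha>\<close> are its
  isotypic components for the four characters and the \<open>\<Pi>\<^sub>\<alpha>\<close> are the character projections: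
  \<open>\<Pi>\<^sub>\<alpha>\<close> maps into \<open>\<B>\<^sub>\<alpha>\<close>, is the identity there and kills the other components.\<close>

text \<open>\<open>P\<close> is additive only on \<open>U\<close>, so the induction also needs each
  partial sum to lie in \<open>U\<close>, which holds because \<open>U\<close> is a
  subspace.\<close>

lemma linear_operator_on_sum:
  assumes "linear_operator_on U P" "finite I" "\<And>i. i \<in> I \<Longrightarrow> g i \<in> U"
  shows "P (\<Sum>i\<in>I. g i) = (\<Sum>i\<in>I. P (g i))"
  using assms(2,3)
proof (induction I rule: finite_induct)
  case empty
  \<comment> \<open>Homogeneity with the scalar 0 yields \<open>P 0 = 0\<close>.\<close>
  have "P (form_scale 0 0) = form_scale 0 (P 0)"
    using assms(1) form.subspace_0 unfolding linear_operator_on_def by blast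
  then show ?case
    by (simp add: zero_fun_def)
next
  case (insert i I)
  then have "(\<Sum>i\<in>I. g i) \<in> U"
    using assms(1) unfolding linear_operator_on_def by (intro form.subspace_sum) auto
  then have "P (g i + (\<Sum>i\<in>I. g i)) = P (g i) + P (\<Sum>i\<in>I. g i)"
    using insert.prems assms(1) unfolding linear_operator_on_def by blast
  then show ?case
    using insert by (simp only: sum.insert insert_iff simp_thms)
qed

text \<open>The components of \<open>f\<close> are the forms \<open>P i f\<close>, which add up to
  \<open>f\<close>. They are the only choice: applying \<open>P j\<close> to any decomposition
  annihilates all summands except the \<open>j\<close>-th, which it fixes.\<close>

lemma is_direct_sum_projections:
  assumes "finite I" "form.subspace U"
    and W: "\<And>i. i \<in> I \<Longrightarrow> form.subspace (W i)" "\<And>i. i \<in> I \<Longrightarrow> W i \<subseteq> U"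
    and P: "\<And>i. i \<in> I \<Longrightarrow> linear_operator_on U (P i)"
    and P_in: "\<And>i f. i \<in> I \<Longrightarrow> f \<in> U \<Longrightarrow> P i f \<in> W i"
    and P_on: "\<And>i j f. i \<in> I \<Longrightarrow> j \<in> I \<Longrightarrow> f \<in> W i \<Longrightarrow> P j f = (if j = i then f else 0)"
    and sum_P: "\<And>f. f \<in> U \<Longrightarrow> (\<Sum>i\<in>I. P i f) = f"
  shows "is_direct_sum U I W"
proof -
  have "\<exists>!g. g \<in> PiE I W \<and> f = (\<Sum>i\<in>I. g i)" if f: "f \<in> U" for f
  \<comment> \<open>The witness is restricted to \<open>I\<close> because members of
    \<open>PiE I W\<close> are \<open>undefined\<close> outside \<open>I\<close>.\<close>
  proof (rule ex1I[of _ "\<lambda>i\<in>I. P i f"])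
    show "(\<lambda>i\<in>I. P i f) \<in> PiE I W \<and> f = (\<Sum>i\<in>I. (\<lambda>i\<in>I. P i f) i)"
      using f P_in sum_P by simp
  next
    fix g assume g: "g \<in> PiE I W \<and> f = (\<Sum>i\<in>I. g i)"
    have "g j = P j f" if j: "j \<in> I" for j
    proof -
      have "P j f = (\<Sum>i\<in>I. P j (g i))"
        using g W(2) P[OF j] assms(1) linear_operator_on_sum[of U "P j" I g] by blast
      also have "\<dots> = (\<Sum>i\<in>I. if j = i then g i else 0)"
        using P_on[OF _ j PiE_mem[OF conjunct1[OF g]]] by (intro sum.cong) simp_all
      also have "\<dots> = g j"
        using j assms(1) by simp
      finally show ?thesis ..
    qed
    then show "g = (\<lambda>i\<in>I. P i f)"
      using PiE_arb[OF conjunct1[OF g]] by (auto simp: restrict_def fun_eq_iff)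
  qed
  then show ?thesis
    using assms(1,2) W unfolding is_direct_sum_def by (intro conjI ballI)
qed

text \<open>The quaternion multiplication table, as rewrite rules that reduce any product of two
  \<open>J\<close>s to a single one up to sign.\<close>

lemma hypercomplex_structureE:
  assumes "hypercomplex_structure H"
  obtains J1 J2 J3 where "H = (J1, J2, J3)" "linear J1" "linear J2" "linear J3"
    "\<And>x. J1 (J1 x) = - x" "\<And>x. J2 (J2 x) = - x" "\<And>x. J3 (J3 x) = - x"
    "\<And>x. J1 (J2 x) = J3 x" "\<And>x. J2 (J1 x) = - J3 x"
    "\<And>x. J2 (J3 x) = J1 x" "\<And>x. J3 (J2 x) = - J1 x"
    "\<And>x. J3 (J1 x) = J2 x" "\<And>x. J1 (J3 x) = - J2 x"
proof -
  obtain J1 J2 J3 where H: "H = (J1, J2, J3)"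
    by (cases H) auto
  have cs: "complex_structure (cmp H \<alpha>)" if "\<alpha> \<in> {1, 2, 3}" for \<alpha>
    using assms that unfolding hypercomplex_structure_def by blast
  have ac: "cmp H \<alpha> (cmp H \<beta> x) = - cmp H \<beta> (cmp H \<alpha> x)"
    if "\<alpha> \<in> {1, 2, 3}" "\<beta> \<in> {1, 2, 3}" "\<alpha> \<noteq> \<beta>" for \<alpha> \<beta> x
    using assms that unfolding hypercomplex_structure_def by blast
  have lin: "linear J1" "linear J2" "linear J3"
    and sq: "J1 (J1 x) = - x" "J2 (J2 x) = - x" "J3 (J3 x) = - x" for x
    using cs[of 1] cs[of 2] cs[of 3] by (simp_all add: H complex_structure_def)
  \<comment> \<open>Each rule points towards a cyclic product \<open>J1 J2\<close>,
    \<open>J2 J3\<close> or \<open>J3 J1\<close>, so rewriting with all three does not loop.\<close>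
  have anti: "J2 (J1 x) = - J1 (J2 x)" "J3 (J2 x) = - J2 (J3 x)" "J1 (J3 x) = - J3 (J1 x)" for x
    using ac[of 2 1 x] ac[of 3 2 x] ac[of 1 3 x] by (simp_all add: H)
  have "cmp H 3 = cmp H 1 \<circ> cmp H 2"
    using assms unfolding hypercomplex_structure_def by blast
  then have J3: "J3 x = J1 (J2 x)" for x
    by (simp add: H)
  have neg: "J1 (- x) = - J1 x" "J2 (- x) = - J2 x" for x
    using lin by (simp_all add: linear_neg)
  \<comment> \<open>Here \<open>J2 J3 = J2 J1 J2 = - J1 J2 J2 = J1\<close> and
    \<open>J3 J1 = J1 J2 J1 = - J1 J1 J2 = J2\<close>.\<close>
  have J23: "J2 (J3 x) = J1 x" and J31: "J3 (J1 x) = J2 x" for x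
    by (simp_all add: J3 anti(1) sq neg)
  show thesis
    by (rule that[OF H lin sq]) (simp_all only: anti J3[symmetric] J23 J31)
qed

text \<open>The first rule has \<open>Suc 0\<close> on the left because the simplifier turns the
  natural number 1 into that form.\<close>

lemma cyc_simps [simp]: "cyc (Suc 0) = 2" "cyc 2 = 3" "cyc 3 = 1"
  by (simp_all add: cyc_def)

lemma bilinear_formsI:
  fixes f :: "('v::real_vector) form"
  assumes "\<And>x x' y. f (x + x') y = f x y + f x' y" "\<And>x y y'. f x (y + y') = f x y + f x y'"
    "\<And>c x y. f (c *\<^sub>R x) y = c * f x y" "\<And>c x y. f x (c *\<^sub>R y) = c * f x y"
  shows "f \<in> bilinear_forms"
  using assms by (simp add: bilinear_forms_def bilinear_def linear_iff)

text \<open>The fifth fact makes signs such as the one in \<open>J2 J1 = - J3\<close> disappear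
  inside a form.\<close>

lemma bilinear_formsD:
  fixes f :: "('v::real_vector) form"
  assumes "f \<in> bilinear_forms"
  shows "f (x + x') y = f x y + f x' y" "f x (y + y') = f x y + f x y'"
    "f (c *\<^sub>R x) y = c * f x y" "f x (c *\<^sub>R y) = c * f x y" "f (- x) (- y) = f x y"
  using assms
  by (simp_all add: bilinear_forms_def bilinear_ladd bilinear_radd bilinear_lmul bilinear_rmul
      bilinear_lneg bilinear_rneg)

lemma subspace_bilinear_forms: "form.subspace (bilinear_forms :: ('v::real_vector) form set)"
  unfolding form.subspace_def
  by (auto intro!: bilinear_formsI simp: bilinear_formsD form_scale_def algebra_simps)

lemma form_space_subset: "form_space H \<alpha> \<subseteq> bilinear_forms"
  by (auto simp: form_space_def)

text \<open>The chain of equalities becomes three eigenvalue equations with eigenvalues 1, -1, -1,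
  usable for rewriting.\<close>

lemma pseudo_hermitian_iff:
  "pseudo_hermitian H \<alpha> f \<longleftrightarrow> (\<forall>x y. f (cmp H \<alpha> x) (cmp H \<alpha> y) = f x y \<and>
     f (cmp H (cyc \<alpha>) x) (cmp H (cyc \<alpha>) y) = - f x y \<and>
     f (cmp H (cyc (cyc \<alpha>)) x) (cmp H (cyc (cyc \<alpha>)) y) = - f x y)"
  unfolding pseudo_hermitian_def Let_def by (smt (verit))

lemma subspace_form_space: "form.subspace (form_space H \<alpha>)"
proof -
  note U = subspace_bilinear_forms
  show ?thesis
    unfolding form.subspace_def
    by (auto simp: form_space_def hermitian_def pseudo_hermitian_iff form_scale_def
        form.subspace_0[OF U] form.subspace_add[OF U]
        form.subspace_scale[OF U, unfolded form_scale_def])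
qed

text \<open>Substituting \<open>J i x\<close>, \<open>J i y\<close> permutes the four terms of the
  average; the coefficients change by the common sign that the type \<alpha> prescribes for
  \<open>J i\<close>.\<close>

lemma form_proj_in_form_space:
  assumes "hypercomplex_structure H" "\<alpha> \<in> {0, 1, 2, 3}" "f \<in> bilinear_forms"
  shows "form_proj H \<alpha> f \<in> form_space H \<alpha>"
proof -
  from assms(1) obtain J1 J2 J3 where J: "H = (J1, J2, J3)" "linear J1" "linear J2" "linear J3"
    "\<And>x. J1 (J1 x) = - x" "\<And>x. J2 (J2 x) = - x" "\<And>x. J3 (J3 x) = - x"
    "\<And>x. J1 (J2 x) = J3 x" "\<And>x. J2 (J1 x) = - J3 x"
    "\<And>x. J2 (J3 x) = J1 x" "\<And>x. J3 (J2 x) = - J1 x"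
    "\<And>x. J3 (J1 x) = J2 x" "\<And>x. J1 (J3 x) = - J2 x"
    using hypercomplex_structureE by blast
  note lin = J(2-4)[THEN linear_add] J(2-4)[THEN linear_scale]
  have "form_proj H \<alpha> f \<in> bilinear_forms"
    using assms(2) unfolding J(1) form_proj_def Let_def
    by (intro bilinear_formsI)
      (auto simp: lin bilinear_formsD[OF assms(3)] field_simps)
  moreover have "if \<alpha> = 0 then hermitian H (form_proj H \<alpha> f)
      else pseudo_hermitian H \<alpha> (form_proj H \<alpha> f)"
    using assms(2) unfolding J(1) form_proj_def hermitian_def pseudo_hermitian_iff Let_def
    by (elim insertE emptyE) (simp_all add: J(5-) bilinear_formsD(5)[OF assms(3)] field_simps)
  ultimately show ?thesis
    by (simp add: form_space_def split: if_splits)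
qed

text \<open>Every term of the average is \<open>f\<close> or \<open>- f\<close>; by orthogonality of
  characters the signed terms add up to \<open>4 f\<close> or cancel.\<close>

lemma form_proj_on_form_space:
  assumes "\<alpha> \<in> {0, 1, 2, 3}" "\<beta> \<in> {0, 1, 2, 3}" "f \<in> form_space H \<alpha>"
  shows "form_proj H \<beta> f = (if \<beta> = \<alpha> then f else 0)"
proof -
  \<comment> \<open>\<open>s\<close> is the character of type \<alpha>: \<open>s i\<close> is the
    eigenvalue belonging to \<open>J i\<close>.\<close>
  define s :: "nat \<Rightarrow> real" where "s i = (if \<alpha> = 0 \<or> i = \<alpha> then 1 else -1)" for i
  have "f (cmp H i x) (cmp H i y) = s i * f x y" if "i \<in> {1, 2, 3}" for i x y
    using assms(1,3) that
    by (auto simp: form_space_def hermitian_def pseudo_hermitian_iff s_def split: if_splits)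
  then have "f (cmp H 1 x) (cmp H 1 y) = s 1 * f x y" "f (cmp H 2 x) (cmp H 2 y) = s 2 * f x y"
    "f (cmp H 3 x) (cmp H 3 y) = s 3 * f x y" for x y
    by auto
  then show ?thesis
    using assms(1,2) by (auto simp: form_proj_def fun_eq_iff s_def)
qed

lemma linear_operator_on_form_proj:
  assumes "hypercomplex_structure H" "\<alpha> \<in> {0, 1, 2, 3}"
  shows "linear_operator_on bilinear_forms (form_proj H \<alpha>)"
  unfolding linear_operator_on_def
proof (intro conjI ballI allI)
  show "form_proj H \<alpha> ` bilinear_forms \<subseteq> bilinear_forms"
    using form_proj_in_form_space[OF assms] form_space_subset by blast
qed (auto simp: subspace_bilinear_forms form_proj_def form_scale_def fun_eq_iff Let_def field_simps)

text \<open>Each term \<open>f (J i x) (J i y)\<close> occurs twice with either sign and cancels,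
  while \<open>f x y\<close> occurs four times with weight 1/4.\<close>

lemma form_proj_sum:
  "form_proj H 0 f + form_proj H 1 f + form_proj H 2 f + form_proj H 3 f = f"
  by (simp add: form_proj_def fun_eq_iff field_simps)

theorem proposition1p1:
  fixes H :: "('v::real_vector) endo_triple" and n :: nat
  assumes "\<exists>B::'v set. finite B \<and> span B = UNIV"
    and "dim (UNIV :: 'v set) = 4 * n"
    and "hypercomplex_structure H"
  shows "is_direct_sum (bilinear_forms :: 'v form set) {0,1,2,3} (form_space H)
    \<and> (\<forall>\<alpha>\<in>{0,1,2,3}. linear_operator_on bilinear_forms (form_proj H \<alpha>))
    \<and> (\<forall>\<alpha>\<in>{0,1,2,3}. form_space H \<alpha> = form_proj H \<alpha> ` bilinear_forms)
    \<and> (\<forall>\<alpha>\<in>{0,1,2,3}. \<forall>f\<in>bilinear_forms. (form_proj H \<alpha> \<circ> form_proj H \<alpha>) f = form_proj H \<alpha> f)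
    \<and> (\<forall>f\<in>bilinear_forms. form_proj H 0 f + form_proj H 1 f + form_proj H 2 f + form_proj H 3 f = f)
    \<and> (\<forall>\<alpha>\<in>{0,1,2,3}. \<forall>\<beta>\<in>{0,1,2,3}. \<alpha> \<noteq> \<beta> \<longrightarrow>
         (\<forall>f\<in>bilinear_forms. (form_proj H \<alpha> \<circ> form_proj H \<beta>) f = 0 \<and> (form_proj H \<beta> \<circ> form_proj H \<alpha>) f = 0))"
proof -
  note H = assms(3)
  let ?I = "{0, 1, 2, 3} :: nat set"
  note P_in = form_proj_in_form_space[OF H] and P_on = form_proj_on_form_space[of _ _ _ H]
  \<comment> \<open>Since \<open>form_proj H \<beta> f\<close> lies in the space of type \<beta>,
    where each projector is the identity or zero, idempotence and the vanishing of mixed products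
    come together.\<close>
  have comp: "form_proj H \<alpha> (form_proj H \<beta> f) = (if \<alpha> = \<beta> then form_proj H \<beta> f else 0)"
    if "\<alpha> \<in> ?I" "\<beta> \<in> ?I" "f \<in> bilinear_forms" for \<alpha> \<beta> f
    by (rule P_on[OF that(2,1) P_in[OF that(2,3)]])
  have "is_direct_sum bilinear_forms ?I (form_space H)"
  proof (rule is_direct_sum_projections[where P = "form_proj H"])
    show "(\<Sum>\<alpha>\<in>?I. form_proj H \<alpha> f) = f" for f
      using form_proj_sum[of H f] by (simp add: add.assoc)
  qed (simp_all only: finite.intros subspace_bilinear_forms subspace_form_space form_space_subset
      linear_operator_on_form_proj[OF H] P_in P_on)
  moreover have "form_space H \<alpha> = form_proj H \<alpha> ` bilinear_forms" if \<alpha>: "\<alpha> \<in> ?I" for \<alpha>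
  proof
    show "form_space H \<alpha> \<subseteq> form_proj H \<alpha> ` bilinear_forms"
    proof
      \<comment> \<open>A form of type \<alpha> is its own preimage.\<close>
      fix f assume f: "f \<in> form_space H \<alpha>"
      then have "form_proj H \<alpha> f = f"
        using P_on[OF \<alpha> \<alpha>] by simp
      then show "f \<in> form_proj H \<alpha> ` bilinear_forms"
        using f form_space_subset by (metis imageI subsetD)
    qed
  qed (use P_in[OF \<alpha>] in blast)
  ultimately show ?thesis
    using linear_operator_on_form_proj[OF H] comp form_proj_sum[of H] unfolding comp_def by simp
qed

end
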